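(* For any finite-dimensional complex Lie algebra $\mathfrak{g}$, the direct product Lie algebra $\mathfrak{g}\oplus\mathfrak{g}$ contracts onto the semi-direct product Lie algebra $\mathfrak{g}\rtimes\mathfrak{g}$.
   Context: The direct product Lie algebra $\mathfrak{g}\oplus\mathfrak{g}$ is the vector space $\mathfrak{g}\oplus\mathfrak{g}$ with bracket $[(m,g),(m',g')]_{\oplus}=([m,m'],[g,g'])$. The semi-direct product $\mathfrak{g}\rtimes\mathfrak{g}$ is the same vector space with bracket $[(m,g),(m',g')]=([g,m']-[g',m],[g,g'])$; that is, the first factor is viewed as the adjoint $\mathfrak{g}$-module and as an abelian Lie algebra. A Lie algebra $(V,[\cdot,\cdot]_a)$ contracts onto a Lie algebra $(V,[\cdot,\cdot]_b)$ with the same finite-dimensional complex underlying vector space $V$ if there is a family $(\psi_t)_{t\in\mathbb{C}\setminus\{0\}}$ of invertible linear maps $\psi_t:V\to V$ such that $\lim_{t\to 0}\psi_t^{-1}([\psi_t(x),\psi_t(y)]_a)=[x,y]_b$ for all $x,y\in V$. *)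

theory Defs
  imports "HOL-Analysis.Analysis"
begin

text \<open>The underlying vector space is a whole type, with an arbitrary complex scalar multiplication;
  no norm or topology on it is assumed.\<close>

locale complex_lie_algebra = vector_space sc
  for sc :: "complex \<Rightarrow> 'v::ab_group_add \<Rightarrow> 'v" +
  fixes br :: "'v \<Rightarrow> 'v \<Rightarrow> 'v"
  assumes linear_right: "Vector_Spaces.linear sc sc (\<lambda>y. br x y)"
    and linear_left: "Vector_Spaces.linear sc sc (\<lambda>x. br x y)"
    and alternating: "br x x = 0"
    and jacobi: "br x (br y z) + br y (br z x) + br z (br x y) = 0"

locale fin_dim_complex_lie_algebra = complex_lie_algebra sc br
  for sc :: "complex \<Rightarrow> 'v::ab_group_add \<Rightarrow> 'v" and br :: "'v \<Rightarrow> 'v \<Rightarrow> 'v" +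
  assumes finite_dimensional: "\<exists>B. finite B \<and> span B = UNIV"

text \<open>The usual topology of a finite-dimensional complex vector space, defined as the coarsest
  topology making all linear functionals continuous. The lemmas below show that it is the topology
  of coordinatewise convergence in any finite basis, and that on \<open>\<complex>\<^sup>n\<close> it is the
  euclidean topology.\<close>

definition fin_dim_topology :: "(complex \<Rightarrow> 'v::ab_group_add \<Rightarrow> 'v) \<Rightarrow> 'v topology" where
  "fin_dim_topology sc =
     topology_generated_by {f -` U | f U. Vector_Spaces.linear sc (*) f \<and> open U}"

definition direct_bracket ::
  "('v \<Rightarrow> 'v \<Rightarrow> 'v) \<Rightarrow> 'v \<times> 'v \<Rightarrow> 'v \<times> 'v \<Rightarrow> 'v \<times> 'v" where
  "direct_bracket br = (\<lambda>(m, g) (m', g'). (br m m', br g g'))"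

definition semidirect_bracket ::
  "('v::ab_group_add \<Rightarrow> 'v \<Rightarrow> 'v) \<Rightarrow> 'v \<times> 'v \<Rightarrow> 'v \<times> 'v \<Rightarrow> 'v \<times> 'v" where
  "semidirect_bracket br = (\<lambda>(m, g) (m', g'). (br g m' - br g' m, br g g'))"

text \<open>\<open>\<psi>\<close> is a total function, but only its values at nonzero \<open>t\<close> matter: the filter
  \<open>at 0\<close> is the punctured one.\<close>

definition contracts_onto ::
  "(complex \<Rightarrow> 'v::ab_group_add \<Rightarrow> 'v) \<Rightarrow> ('v \<Rightarrow> 'v \<Rightarrow> 'v) \<Rightarrow> ('v \<Rightarrow> 'v \<Rightarrow> 'v) \<Rightarrow> bool" where
  "contracts_onto sc br_a br_b \<longleftrightarrow>
     fin_dim_complex_lie_algebra sc br_a \<and>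
     fin_dim_complex_lie_algebra sc br_b \<and>
     (\<exists>\<psi> :: complex \<Rightarrow> 'v \<Rightarrow> 'v.
        (\<forall>t. t \<noteq> 0 \<longrightarrow> Vector_Spaces.linear sc sc (\<psi> t) \<and> bij (\<psi> t)) \<and>
        (\<forall>x y. limitin (fin_dim_topology sc)
                 (\<lambda>t. inv (\<psi> t) (br_a (\<psi> t x) (\<psi> t y))) (br_b x y) (at 0)))"

lemma linear_zero_functional:
  assumes "vector_space (sc :: complex \<Rightarrow> 'v::ab_group_add \<Rightarrow> 'v)"
  shows "Vector_Spaces.linear sc (*) (\<lambda>_. 0 :: complex)"
proof -
  interpret vector_space sc by fact
  interpret vector_space_pair sc "(*) :: complex \<Rightarrow> _" ..
  show ?thesis by (rule module_hom_zero)
qed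

lemma topspace_fin_dim_topology:
  assumes "vector_space (sc :: complex \<Rightarrow> 'v::ab_group_add \<Rightarrow> 'v)"
  shows "topspace (fin_dim_topology sc) = UNIV"
proof -
  have "UNIV \<in> {f -` U | f U. Vector_Spaces.linear sc (*) f \<and> open (U :: complex set)}"
    using linear_zero_functional[OF assms] by (auto intro!: exI[of _ "\<lambda>_. 0"] exI[of _ UNIV])
  then show ?thesis unfolding fin_dim_topology_def topology_generated_by_topspace by blast
qed

lemma limitin_fin_dim_topology_iff:
  assumes "vector_space (sc :: complex \<Rightarrow> 'v::ab_group_add \<Rightarrow> 'v)"
  shows "limitin (fin_dim_topology sc) h l F \<longleftrightarrow>
    (\<forall>f. Vector_Spaces.linear sc (*) f \<longrightarrow> ((\<lambda>t. f (h t)) \<longlongrightarrow> f l) F)"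
    (is "?L \<longleftrightarrow> ?R")
proof
  assume L: ?L
  show ?R
  proof (intro allI impI topological_tendstoI)
    fix f and U :: "complex set"
    assume f: "Vector_Spaces.linear sc (*) f" and U: "open U" "f l \<in> U"
    have "openin (fin_dim_topology sc) (f -` U)"
      unfolding fin_dim_topology_def using f U by (intro topology_generated_by_Basis) blast
    with L U have "\<forall>\<^sub>F t in F. h t \<in> f -` U" unfolding limitin_def by blast
    then show "\<forall>\<^sub>F t in F. f (h t) \<in> U" by simp
  qed
next
  assume R: ?R
  have "\<forall>\<^sub>F t in F. h t \<in> S" if S: "openin (fin_dim_topology sc) S" and l: "l \<in> S" for S
  proof -
    have "generate_topology_on {f -` U | f U. Vector_Spaces.linear sc (*) f \<and> open U} S"
      using S unfolding fin_dim_topology_def by (rule openin_topology_generated_by)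
    then show ?thesis using l
    proof (induction rule: generate_topology_on.induct)
      case Empty
      then show ?case by simp
    next
      case (Int a b)
      then show ?case by (auto intro: eventually_conj)
    next
      case (UN K)
      then obtain k where "k \<in> K" "l \<in> k" by blast
      with UN.IH have "\<forall>\<^sub>F t in F. h t \<in> k" by simp
      then show ?case by (rule eventually_mono) (use \<open>k \<in> K\<close> in blast)
    next
      case (Basis s)
      then obtain f U where "s = f -` U" "Vector_Spaces.linear sc (*) f" "open U" by blast
      with R Basis show ?case by (auto dest: topological_tendstoD)
    qed
  qed
  then show ?L unfolding limitin_def using topspace_fin_dim_topology[OF assms] by simp
qed

lemma limitin_fin_dim_topology_iff_coordinates:
  assumes "finite_dimensional_vector_space (sc :: complex \<Rightarrow> 'v::ab_group_add \<Rightarrow> 'v) B"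
  shows "limitin (fin_dim_topology sc) h l F \<longleftrightarrow>
    (\<forall>b\<in>B. ((\<lambda>t. module.representation sc B (h t) b)
             \<longlongrightarrow> module.representation sc B l b) F)"
    (is "?L \<longleftrightarrow> ?R")
proof -
  interpret finite_dimensional_vector_space sc B by fact
  interpret vector_space_pair sc "(*) :: complex \<Rightarrow> _" ..
  have lin: "Vector_Spaces.linear sc (*) (\<lambda>v. representation B v b)" for b
    by unfold_locales
      (auto simp: representation_add representation_scale independent_Basis span_Basis)
  have expand: "f v = (\<Sum>b\<in>B. representation B v b * f b)"
    if f: "Vector_Spaces.linear sc (*) f" for f v
  proof -
    have "v = (\<Sum>b\<in>B. sc (representation B v b) b)"
      using sum_representation_eq[OF independent_Basis _ finite_Basis subset_refl]
      by (simp add: span_Basis)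
    then have "f v = f (\<Sum>b\<in>B. sc (representation B v b) b)" by simp
    also have "\<dots> = (\<Sum>b\<in>B. representation B v b * f b)"
      using f by (simp add: linear_sum linear_scale)
    finally show ?thesis .
  qed
  show ?thesis
  proof
    assume ?L
    then show ?R using lin limitin_fin_dim_topology_iff[OF vector_space_axioms] by blast
  next
    assume R: ?R
    have "((\<lambda>t. f (h t)) \<longlongrightarrow> f l) F" if f: "Vector_Spaces.linear sc (*) f" for f
    proof -
      have "((\<lambda>t. \<Sum>b\<in>B. representation B (h t) b * f b)
              \<longlongrightarrow> (\<Sum>b\<in>B. representation B l b * f b)) F"
        by (intro tendsto_sum tendsto_mult tendsto_const R[rule_format])
      then show ?thesis by (simp only: expand[OF f, symmetric])
    qed
    then show ?L by (simp add: limitin_fin_dim_topology_iff[OF vector_space_axioms])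
  qed
qed

lemma fin_dim_topology_vec: "fin_dim_topology ((*s) :: complex \<Rightarrow> complex ^ 'n \<Rightarrow> _) = euclidean"
proof (rule topology_eq[THEN iffD2], intro allI iffI)
  fix S :: "(complex ^ 'n) set"
  assume "openin (fin_dim_topology (*s)) S"
  then have "generate_topology_on {f -` U | f U. Vector_Spaces.linear (*s) (*) f \<and> open U} S"
    unfolding fin_dim_topology_def by (rule openin_topology_generated_by)
  then have "open S"
  proof (induction rule: generate_topology_on.induct)
    case (Basis s)
    then obtain f :: "complex ^ 'n \<Rightarrow> complex" and U
      where s: "s = f -` U" and f: "Vector_Spaces.linear (*s) (*) f" and U: "open U" by blast
    interpret f: Vector_Spaces.linear "(*s)" "(*)" f by fact
    have "f (r *\<^sub>R x) = r *\<^sub>R f x" for r x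
      using f.scale[of "complex_of_real r" x]
      by (simp add: scaleR_conv_of_real vector_scalar_mult_def scaleR_vec_def)
    then have "linear f" by (intro linearI) (auto simp: f.add)
    then have "continuous_on UNIV f" by (rule linear_continuous_on[OF linear_conv_bounded_linear[THEN iffD1]])
    then show ?case unfolding s using U by (simp add: open_vimage)
  qed auto
  then show "openin euclidean S" by simp
next
  fix S :: "(complex ^ 'n) set"
  assume "openin euclidean S"
  then have S: "open S" by simp
  have proj: "Vector_Spaces.linear (*s) (*) (\<lambda>x :: complex ^ 'n. x $ i)" for i
    by unfold_locales (auto simp: algebra_simps)
  show "openin (fin_dim_topology (*s)) S"
  proof (subst openin_subopen, intro ballI)
    fix x assume "x \<in> S"
    then obtain A where A: "\<And>i. open (A i)" "\<And>i. x $ i \<in> A i"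
      and sub: "\<And>y. (\<forall>i. y $ i \<in> A i) \<Longrightarrow> y \<in> S"
      using S unfolding open_vec_def by metis
    have "openin (fin_dim_topology (*s)) ((\<lambda>x :: complex ^ 'n. x $ i) -` A i)" for i
      unfolding fin_dim_topology_def using proj A by (intro topology_generated_by_Basis) blast
    then have "openin (fin_dim_topology (*s)) (\<Inter>i. (\<lambda>x :: complex ^ 'n. x $ i) -` A i)"
      by (intro openin_Inter) auto
    moreover have "x \<in> (\<Inter>i. (\<lambda>x. x $ i) -` A i)" "(\<Inter>i. (\<lambda>x. x $ i) -` A i) \<subseteq> S"
      using A sub by auto
    ultimately show "\<exists>T. openin (fin_dim_topology (*s)) T \<and> x \<in> T \<and> T \<subseteq> S" by blast
  qed
qed

end

theory Submission
  imports Defs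
begin

text \<open>
  The direct product \<open>\<gg> \<oplus> \<gg>\<close> is the sum of the ideal \<open>\<gg> \<oplus> 0\<close> and the diagonal
  subalgebra \<open>{(g, g)}\<close>, and the diagonal acts on the ideal by the adjoint representation. Written
  in this decomposition, the direct product differs from \<open>\<gg> \<rtimes> \<gg>\<close> only in that the ideal
  carries its own bracket instead of the zero bracket. Rescaling the ideal by \<open>t\<close> multiplies that
  bracket by \<open>t\<close> and leaves the action and the bracket of the diagonal unchanged, so it disappears
  in the limit.

  Both steps together are the map \<open>\<psi>\<^sub>t (m, g) = (t m + g, g)\<close>
  (\<open>diagonal_contraction t\<close>), whose inverse is
  \<open>(a, b) \<mapsto> (t\<^sup>-\<^sup>1 (a - b), b)\<close>. The pulled-back bracket is exactly the semi-direct bracket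
  plus \<open>t ([m, m'], 0)\<close> (lemma \<open>pulled_back_bracket\<close>). A linear functional takes it to an affine
  function of \<open>t\<close>, and the topology is the one generated by the linear functionals; hence the limit.
\<close>

context complex_lie_algebra
begin

sublocale square: vector_space_prod sc sc ..

lemma br_add_left: "br (x + y) z = br x z + br y z"
  and br_add_right: "br x (y + z) = br x y + br x z"
  and br_scale_left: "br (sc c x) y = sc c (br x y)"
  and br_scale_right: "br x (sc c y) = sc c (br x y)"
  using linear_left linear_right by (auto simp: Vector_Spaces.linear_iff)

lemma br_diff_right: "br x (y - z) = br x y - br x z"
  by (metis add_diff_cancel_right' br_add_right diff_add_cancel)

lemmas br_linear_simps =
  br_add_left br_add_right br_diff_right br_scale_left br_scale_right

lemma br_anticommute: "br y x = - br x y"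
proof -
  have "br x y + br y x = 0"
    using alternating[of "x + y"] alternating[of x] alternating[of y]
    by (simp add: br_add_left br_add_right add.commute)
  then show ?thesis
    by (metis minus_unique)
qed

lemma br_zero_right: "br x 0 = 0"
  by (metis br_diff_right diff_self)

lemma br_uminus_right: "br x (- y) = - br x y"
  using br_diff_right[of x 0 y] by (simp add: br_zero_right)

text \<open>The Jacobi identity in the form needed for the semi-direct product: the adjoint
  representation preserves brackets.\<close>

lemma br_br_left: "br (br x y) z = br x (br y z) - br y (br x z)"
proof -
  have "br z (br x y) = - br (br x y) z" "br y (br z x) = - br y (br x z)"
    by (rule br_anticommute, simp add: br_anticommute[of z x] br_uminus_right)
  then show ?thesis
    using jacobi[of x y z] by (simp add: algebra_simps)
qed

lemma complex_lie_algebra_direct_bracket: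
  "complex_lie_algebra square.scale (direct_bracket br)"
proof (intro complex_lie_algebra.intro complex_lie_algebra_axioms.intro)
  show "vector_space square.scale" by (rule square.p.vector_space_axioms)
next
  fix x y z :: "'v \<times> 'v"
  show "Vector_Spaces.linear square.scale square.scale (\<lambda>y. direct_bracket br x y)"
    and "Vector_Spaces.linear square.scale square.scale (\<lambda>x. direct_bracket br x y)"
    unfolding Vector_Spaces.linear_iff
    by (auto simp: square.p.vector_space_axioms direct_bracket_def square.scale_def
        br_linear_simps split: prod.splits)
  show "direct_bracket br x x = 0"
    by (auto simp: direct_bracket_def alternating zero_prod_def split: prod.splits)
  show "direct_bracket br x (direct_bracket br y z) + direct_bracket br y (direct_bracket br z x)
      + direct_bracket br z (direct_bracket br x y) = 0"
    by (auto simp: direct_bracket_def jacobi zero_prod_def split: prod.splits)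
qed

lemma complex_lie_algebra_semidirect_bracket:
  "complex_lie_algebra square.scale (semidirect_bracket br)"
proof (intro complex_lie_algebra.intro complex_lie_algebra_axioms.intro)
  show "vector_space square.scale" by (rule square.p.vector_space_axioms)
next
  fix x y z :: "'v \<times> 'v"
  show "Vector_Spaces.linear square.scale square.scale (\<lambda>y. semidirect_bracket br x y)"
    and "Vector_Spaces.linear square.scale square.scale (\<lambda>x. semidirect_bracket br x y)"
    unfolding Vector_Spaces.linear_iff
    by (auto simp: square.p.vector_space_axioms semidirect_bracket_def square.scale_def
        br_linear_simps scale_right_diff_distrib split: prod.splits)
  show "semidirect_bracket br x x = 0"
    by (auto simp: semidirect_bracket_def alternating zero_prod_def split: prod.splits)
  show "semidirect_bracket br x (semidirect_bracket br y z)
      + semidirect_bracket br y (semidirect_bracket br z x)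
      + semidirect_bracket br z (semidirect_bracket br x y) = 0"
    by (cases x, cases y, cases z)
      (simp add: semidirect_bracket_def jacobi zero_prod_def br_diff_right br_br_left)
qed

definition diagonal_contraction :: "complex \<Rightarrow> 'v \<times> 'v \<Rightarrow> 'v \<times> 'v" where
  "diagonal_contraction t = (\<lambda>(m, g). (sc t m + g, g))"

lemma linear_diagonal_contraction:
  "Vector_Spaces.linear square.scale square.scale (diagonal_contraction t)"
  unfolding Vector_Spaces.linear_iff
  by (auto simp: square.p.vector_space_axioms diagonal_contraction_def square.scale_def
      scale_right_distrib mult.commute split: prod.splits)

lemma diagonal_contraction_eq_iff:
  assumes "t \<noteq> 0"
  shows "diagonal_contraction t x = (a, b) \<longleftrightarrow> x = (sc (inverse t) (a - b), b)"
  using assms by (cases x) (auto simp: diagonal_contraction_def)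

lemma bij_diagonal_contraction:
  assumes "t \<noteq> 0"
  shows "bij (diagonal_contraction t)"
  unfolding bij_iff using diagonal_contraction_eq_iff[OF assms] by (metis surj_pair)

lemma inv_diagonal_contraction:
  assumes "t \<noteq> 0"
  shows "inv (diagonal_contraction t) (a, b) = (sc (inverse t) (a - b), b)"
  using diagonal_contraction_eq_iff[OF assms] bij_diagonal_contraction[OF assms]
  by (metis bij_inv_eq_iff)

text \<open>In the diagonal coordinates the mixed terms \<open>[t m, g']\<close> and \<open>[g, t m']\<close> carry one factor
  \<open>t\<close> and \<open>[t m, t m']\<close> carries two, while \<open>[g, g']\<close> cancels in the difference of the two
  components; the inverse then removes one factor \<open>t\<close>.\<close>

lemma pulled_back_bracket:
  assumes "t \<noteq> 0"
  shows "inv (diagonal_contraction t)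
      (direct_bracket br (diagonal_contraction t x) (diagonal_contraction t y))
    = semidirect_bracket br x y + square.scale t (br (fst x) (fst y), 0)"
proof -
  obtain m g m' g' where xy: "x = (m, g)" "y = (m', g')"
    by (cases x, cases y)
  have "sc (inverse t) (br (sc t m + g) (sc t m' + g') - br g g')
      = br g m' - br g' m + sc t (br m m')"
    using assms by (simp add: br_linear_simps br_anticommute[of g' m] scale_right_distrib)
  then show ?thesis
    using inv_diagonal_contraction[OF assms]
    by (simp add: xy direct_bracket_def semidirect_bracket_def square.scale_def
        diagonal_contraction_def)
qed

lemma limitin_pulled_back_bracket:
  "limitin (fin_dim_topology square.scale)
    (\<lambda>t. inv (diagonal_contraction t)
      (direct_bracket br (diagonal_contraction t x) (diagonal_contraction t y)))
    (semidirect_bracket br x y) (at 0)"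
  unfolding limitin_fin_dim_topology_iff[OF square.p.vector_space_axioms]
proof (intro allI impI)
  fix f :: "'v \<times> 'v \<Rightarrow> complex"
  assume "Vector_Spaces.linear square.scale (*) f"
  then interpret f: Vector_Spaces.linear square.scale "(*)" f .
  let ?d = "(br (fst x) (fst y), 0)"
  have "((\<lambda>t. f (semidirect_bracket br x y) + t * f ?d)
      \<longlongrightarrow> f (semidirect_bracket br x y) + 0 * f ?d) (at 0)"
    by (intro tendsto_intros)
  moreover have "\<forall>\<^sub>F t in at 0. f (semidirect_bracket br x y) + t * f ?d
      = f (inv (diagonal_contraction t)
          (direct_bracket br (diagonal_contraction t x) (diagonal_contraction t y)))"
    by (auto simp: eventually_at_filter pulled_back_bracket f.add f.scale)
  ultimately show "((\<lambda>t. f (inv (diagonal_contraction t)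
        (direct_bracket br (diagonal_contraction t x) (diagonal_contraction t y))))
      \<longlongrightarrow> f (semidirect_bracket br x y)) (at 0)"
    by (auto intro: Lim_transform_eventually)
qed

end

lemma (in fin_dim_complex_lie_algebra) finite_dimensional_square:
  "\<exists>C. finite C \<and> square.p.span C = UNIV"
proof -
  obtain B where B: "finite B" "span B = UNIV"
    using finite_dimensional by blast
  let ?C = "B \<times> {0} \<union> {0} \<times> B"
  have "(a, b) \<in> square.p.span ?C" for a b
  proof -
    have "(a, 0) \<in> square.p.span (B \<times> {0})" "(0, b) \<in> square.p.span ({0} \<times> B)"
      using B by (simp_all add: square.span_Times_sing1 square.span_Times_sing2)
    then have "(a, 0) + (0, b) \<in> square.p.span ?C"
      by (intro square.p.span_add) (meson square.p.span_mono subsetD sup_ge1 sup_ge2)+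
    then show ?thesis by simp
  qed
  then have "square.p.span ?C = UNIV" by auto
  then show ?thesis using B by (intro exI[of _ ?C]) simp
qed

theorem proposition1p4:
  fixes sc :: "complex \<Rightarrow> 'g::ab_group_add \<Rightarrow> 'g"
    and br :: "'g \<Rightarrow> 'g \<Rightarrow> 'g"
  assumes "fin_dim_complex_lie_algebra sc br"
  shows "contracts_onto (module_prod.scale sc sc)
           (direct_bracket br) (semidirect_bracket br)"
proof -
  interpret fin_dim_complex_lie_algebra sc br by fact
  have "fin_dim_complex_lie_algebra square.scale (direct_bracket br)"
    and "fin_dim_complex_lie_algebra square.scale (semidirect_bracket br)"
    using complex_lie_algebra_direct_bracket complex_lie_algebra_semidirect_bracket
      finite_dimensional_square
    by (simp_all add: fin_dim_complex_lie_algebra_def fin_dim_complex_lie_algebra_axioms_def)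
  then show ?thesis
    unfolding contracts_onto_def
    using linear_diagonal_contraction bij_diagonal_contraction limitin_pulled_back_bracket
    by blast
qed

end
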